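(* Let $A$ be a unital $C^*$-algebra with unit $I$ and let $H$ be a Hilbert $A$-module. Suppose that $\{e_n\}_{n=0}^{\infty}\subseteq H$ satisfies $\langle e_n,e_n\rangle=I$ for all $n\ge0$, and let $\{g_n\}_{n=0}^\infty$ be the auxiliary sequence of $\{e_n\}_{n=0}^\infty$. Then $\{e_n\}_{n=0}^{\infty}$ is effective if and only if $\{g_n\}_{n=0}^{\infty}$ is a standard Parseval frame.
   Context: A Hilbert $A$-module ($A$ a unital $C^*$-algebra) is a complex vector space and left $A$-module $H$ with an inner product $\langle\cdot,\cdot\rangle:H\times H\to A$ such that $\langle x,x\rangle\ge 0$ with equality iff $x=0$, $\langle x,y\rangle=\langle y,x\rangle^*$, and $\langle ax+by,z\rangle=a\langle x,z\rangle+b\langle y,z\rangle$ for $a,b\in A$, and which is complete in the norm $\|x\|=\sqrt{\|\langle x,x\rangle\|_A}$. The auxiliary sequence of $\{e_n\}$ is defined by $g_0=e_0$ and $g_n=e_n-\sum_{k=0}^{n-1}\langle e_n,e_k\rangle g_k$ for $n\ge1$. A sequence $\{e_n\}$ with $\langle e_n,e_n\rangle=I$ for all $n$ is effective if for every $x\in H$ the sequence defined by $x_0=\langle x,e_0\rangle e_0$ and $x_n=x_{n-1}+\langle x-x_{n-1},e_n\rangle e_n$ for $n\ge1$ converges to $x$ in norm. A standard Parseval frame is a sequence $\{g_n\}_{n=0}^\infty\subseteq H$ with $\sum_{n=0}^\infty\langle x,g_n\rangle\langle g_n,x\rangle=\langle x,x\rangle$ for all $x\in H$, the sum converging in the norm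 of $A$. *)

theory Defs
  imports Complex_Main "HOL-Library.Nonpos_Ints"
begin

text \<open>
  The algebra is a whole type. Its unit is the class constant \<open>1\<close> of \<open>monoid_mult\<close>;
  the class \<open>ring_1\<close> is avoided because it would exclude the zero algebra. The type classes
  only provide the real Banach algebra structure, which \<open>of_real_scale\<close> ties to the
  complex one.
\<close>

locale unital_cstar_algebra = vector_space scale
  for scale :: "complex \<Rightarrow> 'a::{real_normed_algebra, monoid_mult, banach} \<Rightarrow> 'a" +
  fixes star :: "'a \<Rightarrow> 'a"
  assumes of_real_scale: "scale (complex_of_real r) a = r *\<^sub>R a"
    and scale_mult_left: "scale c a * b = scale c (a * b)"
    and scale_mult_right: "a * scale c b = scale c (a * b)"
    and norm_scale: "norm (scale c a) = cmod c * norm a"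
    and star_add: "star (a + b) = star a + star b"
    and star_scale: "star (scale c a) = scale (cnj c) (star a)"
    and star_mult: "star (a * b) = star b * star a"
    and star_star: "star (star a) = a"
    and cstar_identity: "norm (star a * a) = (norm a)\<^sup>2"

definition spectrum :: "(complex \<Rightarrow> 'a::{ring, monoid_mult} \<Rightarrow> 'a) \<Rightarrow> 'a \<Rightarrow> complex set" where
  "spectrum scale a =
     {c. \<not> (\<exists>b. b * (a - scale c 1) = 1 \<and> (a - scale c 1) * b = 1)}"

definition cstar_nonneg ::
    "(complex \<Rightarrow> 'a::{ring, monoid_mult} \<Rightarrow> 'a) \<Rightarrow> ('a \<Rightarrow> 'a) \<Rightarrow> 'a \<Rightarrow> bool" where
  "cstar_nonneg scale star a \<longleftrightarrow> star a = a \<and> spectrum scale a \<subseteq> \<real>\<^sub>\<ge>\<^sub>0"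

text \<open>
  The norm of a Hilbert module is derived from the algebra-valued inner product \<open>ip\<close>, so it is
  a function of \<open>ip\<close> and not a type class norm; Cauchy sequences and limits in the module are
  spelled out with it.
\<close>

definition hnorm :: "('h \<Rightarrow> 'h \<Rightarrow> 'a::real_normed_vector) \<Rightarrow> 'h \<Rightarrow> real" where
  "hnorm ip x = sqrt (norm (ip x x))"

definition hconverges ::
    "('h::ab_group_add \<Rightarrow> 'h \<Rightarrow> 'a::real_normed_vector) \<Rightarrow> (nat \<Rightarrow> 'h) \<Rightarrow> 'h \<Rightarrow> bool" where
  "hconverges ip X l \<longleftrightarrow> (\<lambda>n. hnorm ip (X n - l)) \<longlonglongrightarrow> 0"

definition hcauchy ::
    "('h::ab_group_add \<Rightarrow> 'h \<Rightarrow> 'a::real_normed_vector) \<Rightarrow> (nat \<Rightarrow> 'h) \<Rightarrow> bool" where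
  "hcauchy ip X \<longleftrightarrow> (\<forall>\<epsilon>>0. \<exists>N. \<forall>m\<ge>N. \<forall>n\<ge>N. hnorm ip (X m - X n) < \<epsilon>)"

text \<open>\<open>scaleH\<close> is the complex scalar multiplication of the module, \<open>act\<close> the left action of
  the algebra.\<close>

locale hilbert_module =
  unital_cstar_algebra scale star + H: vector_space scaleH
  for scale :: "complex \<Rightarrow> 'a::{real_normed_algebra, monoid_mult, banach} \<Rightarrow> 'a"
    and star :: "'a \<Rightarrow> 'a"
    and scaleH :: "complex \<Rightarrow> 'h::ab_group_add \<Rightarrow> 'h" +
  fixes act :: "'a \<Rightarrow> 'h \<Rightarrow> 'h"
    and ip :: "'h \<Rightarrow> 'h \<Rightarrow> 'a"
  assumes act_add_right: "act a (x + y) = act a x + act a y"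
    and act_add_left: "act (a + b) x = act a x + act b x"
    and act_act: "act a (act b x) = act (a * b) x"
    and act_one: "act 1 x = x"
    and act_scale_left: "act (scale c a) x = scaleH c (act a x)"
    and act_scale_right: "act a (scaleH c x) = scaleH c (act a x)"
    and ip_nonneg: "cstar_nonneg scale star (ip x x)"
    and ip_eq_zero_iff: "ip x x = 0 \<longleftrightarrow> x = 0"
    and ip_star: "ip x y = star (ip y x)"
    and ip_linear: "ip (act a x + act b y) z = a * ip x z + b * ip y z"
    and complete: "hcauchy ip X \<Longrightarrow> \<exists>l. hconverges ip X l"

fun auxiliary ::
    "('a \<Rightarrow> 'h::ab_group_add \<Rightarrow> 'h) \<Rightarrow> ('h \<Rightarrow> 'h \<Rightarrow> 'a) \<Rightarrow> (nat \<Rightarrow> 'h) \<Rightarrow> nat \<Rightarrow> 'h" where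
  "auxiliary act ip e 0 = e 0"
| "auxiliary act ip e (Suc n) =
     e (Suc n) - (\<Sum>k\<le>n. act (ip (e (Suc n)) (e k)) (auxiliary act ip e k))"

primrec kaczmarz ::
    "('a \<Rightarrow> 'h::ab_group_add \<Rightarrow> 'h) \<Rightarrow> ('h \<Rightarrow> 'h \<Rightarrow> 'a) \<Rightarrow> (nat \<Rightarrow> 'h) \<Rightarrow> 'h \<Rightarrow> nat \<Rightarrow> 'h" where
  "kaczmarz act ip e x 0 = act (ip x (e 0)) (e 0)"
| "kaczmarz act ip e x (Suc n) =
     kaczmarz act ip e x n + act (ip (x - kaczmarz act ip e x n) (e (Suc n))) (e (Suc n))"

definition effective ::
    "('a \<Rightarrow> 'h::ab_group_add \<Rightarrow> 'h) \<Rightarrow> ('h \<Rightarrow> 'h \<Rightarrow> 'a::real_normed_vector) \<Rightarrow> (nat \<Rightarrow> 'h) \<Rightarrow> bool" where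
  "effective act ip e \<longleftrightarrow> (\<forall>x. hconverges ip (kaczmarz act ip e x) x)"

definition standard_parseval_frame ::
    "('h \<Rightarrow> 'h \<Rightarrow> 'a::real_normed_algebra) \<Rightarrow> (nat \<Rightarrow> 'h) \<Rightarrow> bool" where
  "standard_parseval_frame ip g \<longleftrightarrow> (\<forall>x. (\<lambda>n. ip x (g n) * ip (g n) x) sums ip x x)"

end

theory Submission imports Defs begin

text \<open>
  Write \<open>r n = x - x\<^sub>n\<close> for the residual of the Kaczmarz iteration on \<open>x\<close>, with
  \<open>x\<close> itself as the residual before step \<open>0\<close>. Two facts decide the theorem.

  The auxiliary sequence \<open>g\<close> is designed so that the coefficient read off in step \<open>n\<close>, which is
  the inner product of the previous residual with \<open>e n\<close>, equals the inner product of \<open>x\<close> itself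
  with \<open>g n\<close>. Indeed, if \<open>x\<^sub>n\<^sub>-\<^sub>1\<close> has the coefficients \<open>ip x (g k)\<close> at the vectors \<open>e k\<close>, its inner
  product with \<open>e n\<close> is a sum of terms \<open>ip x (g k) * ip (e k) (e n)\<close>, and such a term is the inner
  product of \<open>x\<close> with the term \<open>act (ip (e n) (e k)) (g k)\<close> of the recursion for \<open>g n\<close>
  (\<open>residual_coefficient\<close>, \<open>kaczmarz_expansion\<close>).

  Each step removes from the residual its component along the unit vector \<open>e n\<close>, so by
  Pythagoras the \<open>A\<close>-valued square of the residual drops by exactly the coefficient times its
  adjoint (\<open>ip_remove_unit_component\<close>). Hence \<open>ip (r n) (r n)\<close> is the difference between \<open>ip x x\<close>
  and the \<open>n\<close>-th partial sum of the Parseval series (\<open>ip_kaczmarz_residual\<close>). The squared norm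
  of the residual is the norm of this difference, so for every single \<open>x\<close> the iteration
  converges to \<open>x\<close> exactly when the series converges to \<open>ip x x\<close>.
\<close>

context hilbert_module
begin

lemma additive_ip_left: "additive (\<lambda>x. ip x z)"
proof
  fix x y
  show "ip (x + y) z = ip x z + ip y z"
    using ip_linear[of 1 x 1 y z] by (simp add: act_one)
qed

lemma additive_ip_right: "additive (ip z)"
proof
  fix x y
  show "ip z (x + y) = ip z x + ip z y"
    by (metis additive.add[OF additive_ip_left] ip_star star_add)
qed

lemma act_zero_left: "act 0 x = 0"
  using act_add_left[of 0 0 x] by simp

lemma ip_act_left: "ip (act a x) y = a * ip x y"
  using ip_linear[of a x 0 x y] by (simp add: act_zero_left)

lemma ip_act_right: "ip x (act a y) = ip x y * star a"
  by (metis ip_act_left ip_star star_mult)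

lemmas ip_diff_left = additive.diff[OF additive_ip_left]
  and ip_diff_right = additive.diff[OF additive_ip_right]
  and ip_sum_left = additive.sum[OF additive_ip_left]
  and ip_sum_right = additive.sum[OF additive_ip_right]

text \<open>
  The adjoint of \<open>ip (e (Suc n)) (e k)\<close> is \<open>ip (e k) (e (Suc n))\<close>, so pairing \<open>x\<close> with the recursion
  for the auxiliary sequence gives the same sum as pairing the expansion with \<open>e (Suc n)\<close>.
\<close>

lemma residual_coefficient:
  "ip (x - (\<Sum>k\<le>n. act (ip x (auxiliary act ip e k)) (e k))) (e (Suc n))
     = ip x (auxiliary act ip e (Suc n))"
proof -
  have "star (ip (e (Suc n)) (e k)) = ip (e k) (e (Suc n))" for k
    by (rule ip_star[symmetric])
  then show ?thesis
    by (simp add: ip_diff_left ip_diff_right ip_sum_left ip_sum_right ip_act_left ip_act_right)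
qed

lemma kaczmarz_expansion:
  "kaczmarz act ip e x n = (\<Sum>k\<le>n. act (ip x (auxiliary act ip e k)) (e k))"
proof (induction n)
  case 0
  show ?case by simp
next
  case (Suc n)
  then show ?case
    by (simp add: residual_coefficient del: auxiliary.simps)
qed

text \<open>
  Pythagoras: all three terms of the expansion other than \<open>ip r r\<close> are \<open>ip r u * ip u r\<close> up to
  sign, the quadratic one because \<open>u\<close> is a unit vector, so one copy survives. The order of the
  two factors matters, since the algebra need not be commutative.
\<close>

lemma ip_remove_unit_component:
  assumes "ip u u = 1"
  shows "ip (r - act (ip r u) u) (r - act (ip r u) u) = ip r r - ip r u * ip u r"
proof -
  have "star (ip r u) = ip u r"
    by (rule ip_star[symmetric])
  then show ?thesis
    by (simp add: assms ip_diff_left ip_diff_right ip_act_left ip_act_right)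
qed

lemma ip_kaczmarz_residual:
  fixes e :: "nat \<Rightarrow> 'h" and x :: 'h
  assumes unit: "\<And>n. ip (e n) (e n) = 1"
  defines "g \<equiv> auxiliary act ip e" and "r \<equiv> \<lambda>n. x - kaczmarz act ip e x n"
  shows "ip (r n) (r n) = ip x x - (\<Sum>k\<le>n. ip x (g k) * ip (g k) x)"
proof (induction n)
  case 0
  show ?case
    by (simp add: g_def r_def ip_remove_unit_component unit)
next
  case (Suc n)
  have coeff: "ip (r n) (e (Suc n)) = ip x (g (Suc n))"
    unfolding r_def g_def kaczmarz_expansion by (rule residual_coefficient)
  then have coeff_star: "ip (e (Suc n)) (r n) = ip (g (Suc n)) x"
    by (metis ip_star)
  have "r (Suc n) = r n - act (ip (r n) (e (Suc n))) (e (Suc n))"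
    by (simp add: r_def algebra_simps)
  then have "ip (r (Suc n)) (r (Suc n)) =
      ip (r n) (r n) - ip (r n) (e (Suc n)) * ip (e (Suc n)) (r n)"
    by (simp only: ip_remove_unit_component unit)
  then show ?case
    using Suc by (simp add: coeff coeff_star)
qed

lemma hnorm_minus_commute: "hnorm ip (x - y) = hnorm ip (y - x)"
  by (simp add: hnorm_def ip_diff_left ip_diff_right algebra_simps)

lemma kaczmarz_converges_iff_parseval_sums:
  fixes e :: "nat \<Rightarrow> 'h" and x :: 'h
  assumes unit: "\<And>n. ip (e n) (e n) = 1"
  defines "g \<equiv> auxiliary act ip e"
  shows "hconverges ip (kaczmarz act ip e x) x
           \<longleftrightarrow> (\<lambda>n. ip x (g n) * ip (g n) x) sums ip x x"
proof -
  let ?S = "\<lambda>n. \<Sum>k\<le>n. ip x (g k) * ip (g k) x"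
  have residual: "hnorm ip (kaczmarz act ip e x n - x) = sqrt (norm (?S n - ip x x))" for n
    by (subst hnorm_minus_commute)
      (simp add: hnorm_def ip_kaczmarz_residual[OF unit] g_def norm_minus_commute)
  have "hconverges ip (kaczmarz act ip e x) x \<longleftrightarrow> (\<lambda>n. sqrt (norm (?S n - ip x x))) \<longlonglongrightarrow> sqrt 0"
    by (simp add: hconverges_def residual)
  also have "\<dots> \<longleftrightarrow> (\<lambda>n. norm (?S n - ip x x)) \<longlonglongrightarrow> 0"
  proof
    assume "(\<lambda>n. sqrt (norm (?S n - ip x x))) \<longlonglongrightarrow> sqrt 0"
    from tendsto_power[OF this, of 2]
    show "(\<lambda>n. norm (?S n - ip x x)) \<longlonglongrightarrow> 0" by simp
  qed (rule tendsto_real_sqrt)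
  also have "\<dots> \<longleftrightarrow> ?S \<longlonglongrightarrow> ip x x"
    by (simp add: tendsto_norm_zero_iff LIM_zero_iff)
  finally show ?thesis
    by (simp add: sums_def_le)
qed

end

theorem theorem3p5:
  fixes scale :: "complex \<Rightarrow> 'a::{real_normed_algebra, monoid_mult, banach} \<Rightarrow> 'a"
    and star :: "'a \<Rightarrow> 'a"
    and scaleH :: "complex \<Rightarrow> 'h::ab_group_add \<Rightarrow> 'h"
    and act :: "'a \<Rightarrow> 'h \<Rightarrow> 'h"
    and ip :: "'h \<Rightarrow> 'h \<Rightarrow> 'a"
    and e :: "nat \<Rightarrow> 'h"
  assumes "hilbert_module scale star scaleH act ip"
    and "\<And>n. ip (e n) (e n) = 1"
  shows "effective act ip e \<longleftrightarrow> standard_parseval_frame ip (auxiliary act ip e)"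
  unfolding effective_def standard_parseval_frame_def
  using hilbert_module.kaczmarz_converges_iff_parseval_sums[OF assms] by simp

end
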